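(* Let $f(t)$ be a real-valued monotone concave function on $[0,\infty)$ with $f(0)\ge 0$ and let $A,B\in\mathbb{M}_n^+$. Then there exist unitaries $U,V\in\mathbb{M}_n$ such that $$f(A+B)\le Uf(A)U^* + Vf(B)V^*.$$
   Context: $\mathbb{M}_n$ is the algebra of complex $n\times n$ matrices and $\mathbb{M}_n^+$ is the set of positive semi-definite matrices in it. $X\le Y$ means that $X,Y$ are Hermitian and $Y-X$ is positive semi-definite. $f(A)$ is defined by the usual functional calculus. *)

theory Defs
  imports "HOL-Analysis.Analysis"
begin

definition ctranspose :: "complex ^ 'n ^ 'm \<Rightarrow> complex ^ 'm ^ 'n" where
  "ctranspose A = (\<chi> i j. cnj (A $ j $ i))"

definition hermitian_matrix :: "complex ^ 'n ^ 'n \<Rightarrow> bool" where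
  "hermitian_matrix A \<longleftrightarrow> ctranspose A = A"

definition unitary_matrix :: "complex ^ 'n ^ 'n \<Rightarrow> bool" where
  "unitary_matrix U \<longleftrightarrow> ctranspose U ** U = mat 1 \<and> U ** ctranspose U = mat 1"

(* The quadratic form of a Hermitian matrix is real, so taking its real part loses nothing. *)
definition psd_matrix :: "complex ^ 'n ^ 'n \<Rightarrow> bool" where
  "psd_matrix A \<longleftrightarrow> hermitian_matrix A \<and> (\<forall>x. 0 \<le> Re (\<Sum>i\<in>UNIV. cnj (x $ i) * (A *v x) $ i))"

(* The order \<le> that the library puts on vectors is componentwise and unrelated to this one. *)
definition loewner_le :: "complex ^ 'n ^ 'n \<Rightarrow> complex ^ 'n ^ 'n \<Rightarrow> bool" (infix "\<le>\<^sub>L" 50) where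
  "X \<le>\<^sub>L Y \<longleftrightarrow> hermitian_matrix X \<and> hermitian_matrix Y \<and> psd_matrix (Y - X)"

definition real_diag :: "('n \<Rightarrow> real) \<Rightarrow> complex ^ 'n ^ 'n" where
  "real_diag d = (\<chi> i j. if i = j then complex_of_real (d i) else 0)"

(* f(A) = W diag(f(d_1),...,f(d_n)) W* for any unitary diagonalization A = W diag(d_1,...,d_n) W*.
   Meaningful for Hermitian A only; only the values of f on the spectrum of A matter.
   Independence of the diagonalization is the lemma matrix_fun_eq below. *)
definition matrix_fun :: "(real \<Rightarrow> real) \<Rightarrow> complex ^ 'n ^ 'n \<Rightarrow> complex ^ 'n ^ 'n" where
  "matrix_fun f A = (THE M. \<exists>W d. unitary_matrix W \<and> A = W ** real_diag d ** ctranspose W \<and>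
                                  M = W ** real_diag (f \<circ> d) ** ctranspose W)"

lemma real_diag_mult_left: "(real_diag d ** A) $ i $ j = complex_of_real (d i) * A $ i $ j"
  by (simp add: matrix_matrix_mult_def real_diag_def if_distrib if_distribR cong: if_cong)

lemma real_diag_mult_right: "(A ** real_diag d) $ i $ j = A $ i $ j * complex_of_real (d j)"
  by (simp add: matrix_matrix_mult_def real_diag_def if_distrib if_distribR cong: if_cong)

lemma diagonalization_fun_unique:
  assumes V: "unitary_matrix V" and W: "unitary_matrix W"
    and eq: "V ** real_diag e ** ctranspose V = W ** real_diag d ** ctranspose W"
  shows "V ** real_diag (f \<circ> e) ** ctranspose V = W ** real_diag (f \<circ> d) ** ctranspose W"
proof -
  define Q where "Q = ctranspose V ** W"
  have VV: "ctranspose V ** V = mat 1" "V ** ctranspose V = mat 1"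
    and WW: "ctranspose W ** W = mat 1" "W ** ctranspose W = mat 1"
    using V W by (auto simp: unitary_matrix_def)
  have "ctranspose V ** (V ** real_diag e ** ctranspose V) ** W
      = ctranspose V ** (W ** real_diag d ** ctranspose W) ** W"
    by (simp only: eq)
  then have "(ctranspose V ** V) ** real_diag e ** Q = Q ** real_diag d ** (ctranspose W ** W)"
    by (simp only: Q_def matrix_mul_assoc)
  then have "real_diag e ** Q = Q ** real_diag d"
    by (simp add: VV WW)
  then have entry: "complex_of_real (e i) * Q $ i $ j = Q $ i $ j * complex_of_real (d j)" for i j
    by (metis real_diag_mult_left real_diag_mult_right)
  have "complex_of_real (f (e i)) * Q $ i $ j = Q $ i $ j * complex_of_real (f (d j))" for i j
    using entry[of i j] by (cases "Q $ i $ j = 0") auto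
  then have "real_diag (f \<circ> e) ** Q = Q ** real_diag (f \<circ> d)"
    by (simp add: vec_eq_iff real_diag_mult_left real_diag_mult_right)
  then have "V ** (real_diag (f \<circ> e) ** Q) ** ctranspose W = V ** (Q ** real_diag (f \<circ> d)) ** ctranspose W"
    by simp
  then have "V ** real_diag (f \<circ> e) ** ctranspose V ** (W ** ctranspose W)
      = (V ** ctranspose V) ** W ** real_diag (f \<circ> d) ** ctranspose W"
    by (simp only: Q_def matrix_mul_assoc)
  then show ?thesis
    by (simp add: VV WW)
qed

lemma matrix_fun_eq:
  assumes "unitary_matrix W" and "A = W ** real_diag d ** ctranspose W"
  shows "matrix_fun f A = W ** real_diag (f \<circ> d) ** ctranspose W"
  unfolding matrix_fun_def
proof (rule the_equality)
  show "\<exists>V e. unitary_matrix V \<and> A = V ** real_diag e ** ctranspose V \<and>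
      W ** real_diag (f \<circ> d) ** ctranspose W = V ** real_diag (f \<circ> e) ** ctranspose V"
    using assms by blast
next
  fix M
  assume "\<exists>V e. unitary_matrix V \<and> A = V ** real_diag e ** ctranspose V \<and>
      M = V ** real_diag (f \<circ> e) ** ctranspose V"
  then obtain V e where V: "unitary_matrix V" and "A = V ** real_diag e ** ctranspose V"
    and M: "M = V ** real_diag (f \<circ> e) ** ctranspose V"
    by blast
  with assms(2) have "V ** real_diag e ** ctranspose V = W ** real_diag d ** ctranspose W"
    by simp
  from diagonalization_fun_unique[OF V assms(1) this] M
  show "M = W ** real_diag (f \<circ> d) ** ctranspose W"
    by simp
qed

end

theory Submission
  imports Defs
begin

text \<open>After subtracting the constant \<open>f 0\<close>, the function \<open>f\<close> has a constant sign \<open>\<epsilon>\<close>. Put \<open>C = A + B\<close>,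
  let \<open>D\<close> be the square root of the pseudo-inverse of \<open>C\<close>, let \<open>X\<close> and \<open>Y\<close> be the products of the square roots
  of \<open>A\<close> and \<open>B\<close> with \<open>D\<close>, and let \<open>S\<close> be the square root of \<open>\<bar>f\<bar>(C)\<close>. Then \<open>X* X + Y* Y\<close> is the range
  projection of \<open>C\<close>, and \<open>f 0 = 0\<close> gives
  \<open>f(C) = \<epsilon> S X* X S + \<epsilon> S Y* Y S\<close>. The first summand has the form \<open>\<epsilon> T* T\<close> with \<open>T = X S\<close>, so it is unitarily
  equivalent to \<open>\<epsilon> T T* = X f(C) X*\<close>. Since \<open>X\<close> is a contraction, Jensen's inequality and the
  monotonicity of \<open>f\<close> show that the eigenvalues of \<open>X f(C) X*\<close> are dominated by those of
  \<open>f(X C X*) = f(A)\<close>. The second summand is treated in the same way.\<close>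

section \<open>Conjugate transposes, complex inner products and unitary matrices\<close>

lemma ctranspose_ctranspose [simp]: "ctranspose (ctranspose A) = A"
  by (simp add: ctranspose_def vec_eq_iff)

lemma ctranspose_mult: "ctranspose (A ** B) = ctranspose B ** ctranspose A"
  by (simp add: ctranspose_def matrix_matrix_mult_def vec_eq_iff mult.commute)

lemma ctranspose_add: "ctranspose (A + B) = ctranspose A + ctranspose B"
  by (simp add: ctranspose_def vec_eq_iff)

lemma ctranspose_real_diag [simp]: "ctranspose (real_diag d) = real_diag d"
  by (auto simp: ctranspose_def real_diag_def vec_eq_iff)

lemma matrix_mult_add_left: "(A + B) ** C = A ** C + B ** (C :: 'a::ring_1^'n^'m)"
  by (simp add: matrix_matrix_mult_def vec_eq_iff distrib_right sum.distrib)

lemma matrix_mult_diff_left: "(A - B) ** C = A ** C - B ** (C :: 'a::ring_1^'n^'m)"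
  by (simp add: matrix_matrix_mult_def vec_eq_iff left_diff_distrib sum_subtractf)

lemma matrix_mult_diff_right: "C ** (A - B) = C ** A - C ** (B :: 'a::ring_1^'n^'m)"
  by (simp add: matrix_matrix_mult_def vec_eq_iff right_diff_distrib sum_subtractf)

text \<open>The inner product \<open>\<bullet>\<close> on complex vectors is real-valued, while
  orthogonality over the complex field needs this form. It is conjugate-linear in the first argument
  and has \<open>\<bullet>\<close> as its real part.\<close>

definition cinner :: "complex ^ 'n \<Rightarrow> complex ^ 'n \<Rightarrow> complex" where
  "cinner x y = (\<Sum>i\<in>UNIV. cnj (x $ i) * y $ i)"

lemma inner_eq_Re_cinner: "x \<bullet> y = Re (cinner x y)"
  by (simp add: cinner_def inner_vec_def inner_complex_def)

lemma cinner_commute: "cinner y x = cnj (cinner x y)"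
  by (simp add: cinner_def mult.commute)

lemma cinner_self: "cinner x x = complex_of_real (x \<bullet> x)"
  by (rule complex_eqI) (simp_all add: inner_eq_Re_cinner cinner_def)

lemma cinner_scaleR_right: "cinner x (c *\<^sub>R y) = c *\<^sub>R cinner x y"
  by (simp add: cinner_def scaleR_sum_right)

lemma cinner_scaleR_left: "cinner (c *\<^sub>R x) y = c *\<^sub>R cinner x y"
  by (simp add: cinner_def scaleR_sum_right)

lemma cinner_zero_left [simp]: "cinner 0 x = 0"
  by (simp add: cinner_def)

lemma cinner_adjoint: "cinner x (A *v y) = cinner (ctranspose A *v x) y"
proof -
  have "cinner x (A *v y) = (\<Sum>i\<in>UNIV. \<Sum>j\<in>UNIV. cnj (x $ i) * A $ i $ j * y $ j)"
    by (simp add: cinner_def matrix_vector_mult_def sum_distrib_left mult.assoc)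
  also have "\<dots> = (\<Sum>j\<in>UNIV. \<Sum>i\<in>UNIV. cnj (x $ i) * A $ i $ j * y $ j)"
    by (rule sum.swap)
  also have "\<dots> = cinner (ctranspose A *v x) y"
    by (simp add: cinner_def matrix_vector_mult_def ctranspose_def sum_distrib_right sum_distrib_left mult_ac)
  finally show ?thesis .
qed

lemma inner_adjoint: "x \<bullet> (A *v y) = (ctranspose A *v x) \<bullet> y" for A :: "complex^'n^'m"
  by (simp add: inner_eq_Re_cinner cinner_adjoint)

lemma inner_adjoint': "(A *v y) \<bullet> x = y \<bullet> (ctranspose A *v x)" for A :: "complex^'n^'m"
  by (simp add: inner_adjoint)

lemma psd_matrix_iff: "psd_matrix A \<longleftrightarrow> ctranspose A = A \<and> (\<forall>x. 0 \<le> x \<bullet> (A *v x))"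
  by (simp add: psd_matrix_def hermitian_matrix_def inner_eq_Re_cinner cinner_def)

lemma psd_matrix_add: "psd_matrix A \<Longrightarrow> psd_matrix B \<Longrightarrow> psd_matrix (A + B)"
  by (simp add: psd_matrix_iff ctranspose_add matrix_vector_mult_add_rdistrib inner_add_right)

lemma psd_matrix_congruence: "psd_matrix A \<Longrightarrow> psd_matrix (T ** A ** ctranspose T)"
  using inner_adjoint'[of "ctranspose T"]
  by (simp add: psd_matrix_iff ctranspose_mult matrix_mul_assoc inner_adjoint[of _ T] flip: matrix_vector_mul_assoc)

lemma unitary_matrixI: "ctranspose U ** U = mat 1 \<Longrightarrow> unitary_matrix U"
  by (simp add: unitary_matrix_def matrix_left_right_inverse)

lemma unitary_matrix_ctranspose: "unitary_matrix U \<Longrightarrow> unitary_matrix (ctranspose U)"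
  by (simp add: unitary_matrix_def)

lemma unitary_matrix_mult: "unitary_matrix U \<Longrightarrow> unitary_matrix V \<Longrightarrow> unitary_matrix (U ** V)"
  by (rule unitary_matrixI)
    (metis (no_types, lifting) ctranspose_mult matrix_mul_assoc matrix_mul_rid unitary_matrix_def)

lemma norm_unitary_mult:
  assumes "unitary_matrix U"
  shows "norm (U *v x) = norm x"
  using assms by (simp add: norm_eq_sqrt_inner inner_adjoint unitary_matrix_def matrix_vector_mul_assoc)

lemma linear_matrix_vector_mult_complex: "linear ((*v) (A :: complex^'n^'m))"
  by (rule linearI) (simp add: matrix_vector_right_distrib, simp add: matrix_vector_mult_def vec_eq_iff scaleR_sum_right)

lemma matrix_vector_mult_scaleR_complex: "(A :: complex^'n^'m) *v (c *\<^sub>R x) = c *\<^sub>R (A *v x)"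
  by (simp add: linear_scale linear_matrix_vector_mult_complex)

section \<open>Spectral theorem for Hermitian matrices\<close>

text \<open>A maximizer of the quadratic form on the unit sphere of an invariant subspace is an eigenvector.\<close>

lemma hermitian_eigenvector_in_kernel:
  fixes A M :: "complex ^ 'n ^ 'n"
  assumes A: "ctranspose A = A"
    and inv: "\<And>x. M *v x = 0 \<Longrightarrow> M *v (A *v x) = 0"
    and z: "M *v z = 0" "z \<noteq> 0"
  obtains v e where "M *v v = 0" "norm v = 1" "A *v v = e *\<^sub>R v"
proof -
  define S where "S = {x. M *v x = 0} \<inter> sphere 0 1"
  have cont: "continuous_on X ((*v) B)" for B :: "complex ^ 'n ^ 'n" and X
    using linear_matrix_vector_mult_complex by (simp add: linear_continuous_on linear_conv_bounded_linear)
  have "closed {x. M *v x = 0}"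
    by (rule closed_Collect_eq) (auto intro: cont)
  then have "compact S"
    unfolding S_def using compact_sphere by (rule closed_Int_compact)
  moreover have "(1 / norm z) *\<^sub>R z \<in> S"
    using z by (simp add: S_def matrix_vector_mult_scaleR_complex)
  ultimately obtain v where v: "v \<in> S" and max: "\<And>y. y \<in> S \<Longrightarrow> y \<bullet> (A *v y) \<le> v \<bullet> (A *v v)"
    using continuous_attains_sup[of S "\<lambda>x. x \<bullet> (A *v x)"] cont by (fastforce intro: continuous_on_inner continuous_on_id)
  define e where "e = v \<bullet> (A *v v)"
  \<comment> \<open>Rescaling \<open>y\<close> to norm 1 turns the maximality of \<open>e\<close>
    into a homogeneous statement: \<open>e\<close> times the identity minus \<open>A\<close> is
    nonnegative on the kernel of \<open>M\<close>.\<close>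
  have nonneg: "0 \<le> e * (y \<bullet> y) - y \<bullet> (A *v y)" if "M *v y = 0" for y
  proof (cases "y = 0")
    case False
    have "(1 / norm y) *\<^sub>R y \<in> S"
      using that False by (simp add: S_def matrix_vector_mult_scaleR_complex)
    from max[OF this] show ?thesis
      using False by (simp add: e_def matrix_vector_mult_scaleR_complex field_simps power2_norm_eq_inner flip: power2_eq_square)
  qed simp
  have Mv: "M *v v = 0" and nv: "norm v = 1"
    using v by (auto simp: S_def)
  then have vv: "v \<bullet> v = 1"
    by (simp add: power2_norm_eq_inner[symmetric])
  \<comment> \<open>The residual that has to vanish. Invariance keeps it in the kernel of
    \<open>M\<close>, so \<open>v\<close> may be varied in its direction.\<close>
  define w where "w = A *v v - e *\<^sub>R v"
  have Mw: "M *v w = 0"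
    using Mv inv by (simp add: w_def matrix_vector_mult_diff_distrib matrix_vector_mult_scaleR_complex)
  define c where "c = e * (w \<bullet> w) - w \<bullet> (A *v w)"
  have wA: "v \<bullet> (A *v w) = w \<bullet> (A *v v)"
    using inner_adjoint[of v A w] A by (simp add: inner_commute)
  \<comment> \<open>The first-order coefficient comes from
    \<open>w \<bullet> (A *v v) - e * (v \<bullet> w) = w \<bullet> w\<close>.\<close>
  have quad: "0 \<le> t\<^sup>2 * c - 2 * t * (w \<bullet> w)" for t
  proof -
    have "M *v (v + t *\<^sub>R w) = 0"
      using Mv Mw by (simp add: matrix_vector_right_distrib matrix_vector_mult_scaleR_complex)
    from nonneg[OF this]
    have "0 \<le> e * (v \<bullet> v + 2 * t * (v \<bullet> w) + t\<^sup>2 * (w \<bullet> w))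
        - (e + 2 * t * (w \<bullet> (A *v v)) + t\<^sup>2 * (w \<bullet> (A *v w)))"
      by (simp add: matrix_vector_right_distrib matrix_vector_mult_scaleR_complex inner_add_left
          inner_add_right wA e_def inner_commute algebra_simps power2_eq_square)
    also have "\<dots> = t\<^sup>2 * c - 2 * t * (w \<bullet> w)"
      by (simp add: vv c_def w_def inner_diff_right inner_diff_left inner_commute algebra_simps)
    finally show ?thesis .
  qed
  have "w = 0"
  proof (rule ccontr)
    assume "w \<noteq> 0"
    then have pos: "0 < w \<bullet> w"
      by simp
    \<comment> \<open>A step this small keeps \<open>t\<^sup>2 * c\<close> below
      \<open>t * (w \<bullet> w)\<close>, so the negative first-order term wins.\<close>
    define t where "t = (w \<bullet> w) / (\<bar>c\<bar> + 1)"
    have t: "t > 0" "t * (\<bar>c\<bar> + 1) = w \<bullet> w"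
      using pos by (auto simp: t_def field_simps)
    have "t\<^sup>2 * c \<le> t * (t * (\<bar>c\<bar> + 1))"
      using t(1) by (auto simp: power2_eq_square mult.assoc intro!: mult_left_mono)
    then have "t\<^sup>2 * c \<le> t * (w \<bullet> w)"
      using t by simp
    moreover have "t * (w \<bullet> w) > 0"
      using t pos by simp
    ultimately show False
      using quad[of t] by simp
  qed
  then show thesis
    using that[of v e] Mv nv by (simp add: w_def)
qed

text \<open>The orthogonal complement of a family of eigenvectors is invariant under the Hermitian
  \<open>A\<close>, so it contains a further eigenvector; the induction is on the number of free
  indices. Prescribing part of the basis serves to match the eigenbases of \<open>T* T\<close> and
  \<open>T T*\<close> later.\<close>

lemma hermitian_eigenfamily_extend:
  fixes A :: "complex ^ 'n ^ 'n" and u :: "'n \<Rightarrow> complex ^ 'n"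
  assumes A: "ctranspose A = A"
    and u: "\<And>i j. i \<in> S \<Longrightarrow> j \<in> S \<Longrightarrow> cinner (u i) (u j) = (if i = j then 1 else 0)"
    and eig: "\<And>i. i \<in> S \<Longrightarrow> A *v u i = d i *\<^sub>R u i"
  shows "\<exists>v e. (\<forall>i j. cinner (v i) (v j) = (if i = j then 1 else 0)) \<and>
      (\<forall>i. A *v v i = e i *\<^sub>R v i) \<and> (\<forall>i\<in>S. v i = u i \<and> e i = d i)"
  using u eig
proof (induction "card (-S)" arbitrary: S u d)
  case 0
  then have "S = UNIV"
    by auto
  with 0 show ?case
    by (intro exI[of _ u] exI[of _ d]) auto
next
  case (Suc k)
  then obtain a where a: "a \<notin> S"
    by (metis Suc_not_Zero card.empty ComplI equals0I ComplD)
  \<comment> \<open>The rows with index in \<open>S\<close> are the conjugates of the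
    \<open>u j\<close>, so the kernel is the orthogonal complement of the family. Row
    \<open>a\<close> is zero, so the kernel is not trivial.\<close>
  define M :: "complex ^ 'n ^ 'n" where "M = (\<chi> j. if j \<in> S then (\<chi> k. cnj (u j $ k)) else 0)"
  have M: "M *v x = 0 \<longleftrightarrow> (\<forall>j\<in>S. cinner (u j) x = 0)" for x
    by (auto simp: M_def vec_eq_iff matrix_vector_mult_def cinner_def)
  have "row a M = 0"
    using a by (simp add: row_def M_def vec_eq_iff)
  then have "det M = 0"
    by (rule det_zero_row)
  then have "\<not> invertible M"
    by (simp add: invertible_det_nz)
  then obtain z where z: "M *v z = 0" "z \<noteq> 0"
    using matrix_left_invertible_ker invertible_left_inverse by blast
  have inv: "M *v (A *v x) = 0" if "M *v x = 0" for x
    using that Suc.prems(2) A unfolding M by (auto simp: cinner_adjoint cinner_scaleR_left)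
  obtain v e where v: "M *v v = 0" "norm v = 1" "A *v v = e *\<^sub>R v"
    using hermitian_eigenvector_in_kernel[OF A inv z] .
  have vv: "cinner v v = 1"
    using v(2) by (simp add: cinner_self power2_norm_eq_inner[symmetric])
  have vu: "cinner (u j) v = 0" "cinner v (u j) = 0" if "j \<in> S" for j
    using v(1) that unfolding M by (auto simp: cinner_commute[of v])
  have "k = card (- insert a S)"
    using Suc.hyps(2) a by (metis Compl_insert card_Diff_singleton ComplI diff_Suc_1)
  moreover have "cinner ((u(a := v)) i) ((u(a := v)) j) = (if i = j then 1 else 0)"
    if "i \<in> insert a S" "j \<in> insert a S" for i j
    using that Suc.prems(1) vv vu by auto
  moreover have "A *v (u(a := v)) i = (d(a := e)) i *\<^sub>R (u(a := v)) i" if "i \<in> insert a S" for i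
    using that Suc.prems(2) v(3) by auto
  ultimately obtain v' e' where "(\<forall>i j. cinner (v' i) (v' j) = (if i = j then 1 else 0)) \<and>
    (\<forall>i. A *v v' i = e' i *\<^sub>R v' i) \<and>
    (\<forall>i\<in>insert a S. v' i = (u(a := v)) i \<and> e' i = (d(a := e)) i)"
    using Suc.hyps(1)[of "insert a S" "u(a := v)" "d(a := e)"] by blast
  moreover from this have "\<forall>i\<in>S. v' i = u i \<and> e' i = d i"
    using a by (metis fun_upd_other insertI2)
  ultimately show ?case
    by blast
qed

text \<open>Keeping the eigenvector matrix explicit turns sums, products and the functional calculus
  in one eigenbasis into pointwise operations on the diagonals.\<close>

definition unitary_diag :: "complex ^ 'n ^ 'n \<Rightarrow> ('n \<Rightarrow> real) \<Rightarrow> complex ^ 'n ^ 'n" where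
  "unitary_diag W d = W ** real_diag d ** ctranspose W"

text \<open>Column by column, the eigenvector equations say
  \<open>A ** W = W ** real_diag e\<close>.\<close>

lemma unitary_diag_of_eigenbasis:
  fixes A :: "complex ^ 'n ^ 'n" and v :: "'n \<Rightarrow> complex ^ 'n"
  assumes v: "\<And>i j. cinner (v i) (v j) = (if i = j then 1 else 0)"
    and eig: "\<And>i. A *v v i = e i *\<^sub>R v i"
  defines "W \<equiv> (\<chi> k j. v j $ k)"
  shows "unitary_matrix W" "A = unitary_diag W e"
proof -
  have "ctranspose W ** W = mat 1"
    using v by (simp add: vec_eq_iff matrix_matrix_mult_def ctranspose_def W_def mat_def cinner_def)
  then show W: "unitary_matrix W"
    by (rule unitary_matrixI)
  have "(A ** W) $ i $ j = (W ** real_diag e) $ i $ j" for i j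
  proof -
    have "(A *v v j) $ i = v j $ i * complex_of_real (e j)"
      by (simp only: eig vector_scaleR_component) (simp add: scaleR_conv_of_real)
    then show ?thesis
      unfolding real_diag_mult_right
      by (simp add: matrix_matrix_mult_def W_def matrix_vector_mult_def)
  qed
  then have "A ** W = W ** real_diag e"
    by (simp add: vec_eq_iff)
  then have "A ** (W ** ctranspose W) = unitary_diag W e"
    by (simp add: unitary_diag_def matrix_mul_assoc)
  then show "A = unitary_diag W e"
    using W by (simp add: unitary_matrix_def)
qed

lemma spectral_theorem:
  fixes A :: "complex ^ 'n ^ 'n"
  assumes "ctranspose A = A"
  obtains W d where "unitary_matrix W" "A = unitary_diag W d"
proof -
  obtain v :: "'n \<Rightarrow> complex ^ 'n" and e where "\<And>i j. cinner (v i) (v j) = (if i = j then 1 else 0)"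
    and "\<And>i. A *v v i = e i *\<^sub>R v i"
    using hermitian_eigenfamily_extend[OF assms, of "{}"] by blast
  from unitary_diag_of_eigenbasis[OF this] that show thesis
    by blast
qed


section \<open>Algebra and quadratic forms of diagonalized matrices\<close>

lemma ctranspose_unitary_diag [simp]: "ctranspose (unitary_diag W d) = unitary_diag W d"
  by (simp add: unitary_diag_def ctranspose_mult matrix_mul_assoc)

lemma unitary_diag_mult:
  assumes "unitary_matrix W"
  shows "unitary_diag W g ** unitary_diag W h = unitary_diag W (\<lambda>i. g i * h i)"
proof -
  have "real_diag g ** real_diag h = real_diag (\<lambda>i. g i * h i)"
    by (simp add: vec_eq_iff real_diag_mult_left) (simp add: real_diag_def)
  moreover have "unitary_diag W g ** unitary_diag W h
      = W ** (real_diag g ** ((ctranspose W ** W) ** real_diag h)) ** ctranspose W"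
    by (simp add: unitary_diag_def matrix_mul_assoc)
  ultimately show ?thesis
    using assms by (simp add: unitary_diag_def unitary_matrix_def)
qed

lemma unitary_diag_add: "unitary_diag W g + unitary_diag W h = unitary_diag W (\<lambda>i. g i + h i)"
proof -
  have "real_diag (\<lambda>i. g i + h i) = real_diag g + real_diag h"
    by (simp add: real_diag_def vec_eq_iff)
  then show ?thesis
    by (simp add: unitary_diag_def matrix_add_ldistrib matrix_mult_add_left)
qed

lemma unitary_diag_scaleR: "unitary_diag W (\<lambda>i. c * g i) = c *\<^sub>R unitary_diag W g"
proof -
  have "real_diag (\<lambda>i. c * g i) = c *\<^sub>R real_diag g"
    by (simp add: real_diag_def vec_eq_iff scaleR_conv_of_real[where 'a = complex])
  then show ?thesis
    by (simp add: unitary_diag_def matrix_scalar_ac scalar_matrix_assoc)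
qed

lemma unitary_diag_diff: "unitary_diag W g - unitary_diag W h = unitary_diag W (\<lambda>i. g i - h i)"
  using unitary_diag_add[of W "\<lambda>i. g i - h i" h] by (simp add: algebra_simps)

lemma unitary_diag_const:
  fixes W :: "complex ^ 'n ^ 'n"
  assumes "unitary_matrix W"
  shows "unitary_diag W (\<lambda>_. c) = c *\<^sub>R mat 1"
proof -
  have "real_diag (\<lambda>_. 1) = (mat 1 :: complex ^ 'n ^ 'n)"
    by (simp add: real_diag_def mat_def vec_eq_iff)
  then have "unitary_diag W (\<lambda>_. 1) = mat 1"
    using assms by (simp only: unitary_diag_def unitary_matrix_def matrix_mul_rid)
  then show ?thesis
    using unitary_diag_scaleR[of W c "\<lambda>_. 1"] by simp
qed

lemma matrix_fun_unitary_diag: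
  "unitary_matrix W \<Longrightarrow> matrix_fun f (unitary_diag W d) = unitary_diag W (\<lambda>i. f (d i))"
  using matrix_fun_eq[of W "unitary_diag W d" d f] by (simp add: unitary_diag_def comp_def)

lemma real_diag_mult_vector: "(real_diag d *v x) $ i = d i *\<^sub>R x $ i"
  by (simp add: real_diag_def matrix_vector_mult_def scaleR_conv_of_real if_distrib if_distribR cong: if_cong)

text \<open>In the eigenbasis the form is a weighted sum of the eigenvalues. The weights add up to
  the squared norm of \<open>x\<close>, which is how convex combinations and Jensen's inequality
  come in.\<close>

lemma inner_unitary_diag:
  "x \<bullet> (unitary_diag W g *v x) = (\<Sum>i\<in>UNIV. (cmod ((ctranspose W *v x) $ i))\<^sup>2 * g i)"
proof -
  have "x \<bullet> (unitary_diag W g *v x) = (ctranspose W *v x) \<bullet> (real_diag g *v (ctranspose W *v x))"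
    by (simp add: unitary_diag_def inner_adjoint[of _ W] flip: matrix_vector_mul_assoc)
  then show ?thesis
    by (simp add: inner_vec_def real_diag_mult_vector power2_norm_eq_inner mult.commute)
qed

lemma unitary_coordinates_power2_norm:
  assumes "unitary_matrix W"
  shows "(\<Sum>i\<in>UNIV. (cmod ((ctranspose W *v x) $ i))\<^sup>2) = (norm x)\<^sup>2"
proof -
  have "(\<Sum>i\<in>UNIV. (cmod ((ctranspose W *v x) $ i))\<^sup>2) = (norm (ctranspose W *v x))\<^sup>2"
    by (simp add: power2_norm_eq_inner inner_vec_def)
  then show ?thesis
    using assms by (simp add: norm_unitary_mult unitary_matrix_ctranspose)
qed

lemma unitary_diag_eigenvector:
  assumes "unitary_matrix W"
  shows "unitary_diag W d *v (W *v axis i 1) = d i *\<^sub>R (W *v axis i 1)"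
proof -
  have "unitary_diag W d *v (W *v axis i 1) = W *v (real_diag d *v ((ctranspose W ** W) *v axis i 1))"
    by (simp add: unitary_diag_def matrix_vector_mul_assoc matrix_mul_assoc)
  also have "\<dots> = W *v (d i *\<^sub>R axis i 1)"
  proof -
    have "real_diag d *v axis i 1 = d i *\<^sub>R axis i 1"
      by (simp add: vec_eq_iff real_diag_mult_vector) (simp add: axis_def)
    then show ?thesis
      using assms by (simp add: unitary_matrix_def)
  qed
  finally show ?thesis
    by (simp add: matrix_vector_mult_scaleR_complex)
qed

lemma cinner_unitary_columns:
  assumes "unitary_matrix W"
  shows "cinner (W *v axis i 1) (W *v axis j 1) = (if i = j then 1 else 0)"
proof -
  have "cinner (W *v axis i 1) (W *v axis j 1) = cinner (axis i 1) (axis j 1)"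
    using assms by (simp add: cinner_adjoint[of _ W] matrix_vector_mul_assoc unitary_matrix_def)
  also have "\<dots> = (if i = j then 1 else 0)"
  proof -
    have "cinner (axis i 1) (axis j 1) = (\<Sum>k\<in>UNIV. if k = i then (if i = j then 1 else 0) else 0)"
      unfolding cinner_def by (rule sum.cong) (auto simp: axis_def)
    then show ?thesis
      by simp
  qed
  finally show ?thesis .
qed

lemma psd_unitary_diag_iff:
  assumes "unitary_matrix W"
  shows "psd_matrix (unitary_diag W d) \<longleftrightarrow> (\<forall>i. 0 \<le> d i)"
proof
  assume psd: "psd_matrix (unitary_diag W d)"
  have "0 \<le> d i" for i
  proof -
    let ?v = "W *v axis i 1"
    have "?v \<bullet> ?v = 1"
      using cinner_unitary_columns[OF assms, of i i] by (simp add: inner_eq_Re_cinner)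
    then have "?v \<bullet> (unitary_diag W d *v ?v) = d i"
      using assms by (simp add: unitary_diag_eigenvector)
    then show ?thesis
      using psd unfolding psd_matrix_iff by metis
  qed
  then show "\<forall>i. 0 \<le> d i" ..
qed (simp add: psd_matrix_iff inner_unitary_diag sum_nonneg)

lemma psd_matrix_unitary_diag:
  assumes "psd_matrix A"
  obtains W d where "unitary_matrix W" "A = unitary_diag W d" "\<And>i. 0 \<le> d i"
proof -
  obtain W d where "unitary_matrix W" "A = unitary_diag W d"
    using spectral_theorem assms unfolding psd_matrix_iff by blast
  with assms that show thesis
    by (simp add: psd_unitary_diag_iff)
qed

section \<open>Eigenvalue domination by counting\<close>

text \<open>Greedy matching: a maximum of \<open>p\<close> is paired with a maximum of
  \<open>q\<close>, and the rest is matched recursively. In the application \<open>p\<close> and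
  \<open>q\<close> are eigenvalues with multiplicity, and the counts come from a comparison of
  dimensions.\<close>

lemma bij_betw_of_card_superlevel_le:
  fixes p :: "'a \<Rightarrow> real" and q :: "'b \<Rightarrow> real"
  assumes "finite A" "finite B" "card A = card B"
    and "\<And>t. card {i\<in>A. t < p i} \<le> card {j\<in>B. t < q j}"
  shows "\<exists>\<sigma>. bij_betw \<sigma> A B \<and> (\<forall>i\<in>A. p i \<le> q (\<sigma> i))"
  using assms
proof (induction "card A" arbitrary: A B)
  case 0
  then show ?case
    by (auto simp: bij_betw_def)
next
  case (Suc k)
  then have ne: "A \<noteq> {}" "B \<noteq> {}"
    by auto
  obtain a where a: "a \<in> A" "\<And>i. i \<in> A \<Longrightarrow> p i \<le> p a"
  proof -
    have "Max (p ` A) \<in> p ` A"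
      using Suc.prems(1) ne by simp
    then obtain a where "Max (p ` A) = p a" "a \<in> A"
      by (rule imageE)
    moreover have "p i \<le> Max (p ` A)" if "i \<in> A" for i
      using that Suc.prems(1) by simp
    ultimately show ?thesis
      using that by simp
  qed
  obtain b where b: "b \<in> B" "\<And>j. j \<in> B \<Longrightarrow> q j \<le> q b"
  proof -
    have "Max (q ` B) \<in> q ` B"
      using Suc.prems(2) ne by simp
    then obtain b where "Max (q ` B) = q b" "b \<in> B"
      by (rule imageE)
    moreover have "q j \<le> Max (q ` B)" if "j \<in> B" for j
      using that Suc.prems(2) by simp
    ultimately show ?thesis
      using that by simp
  qed
  have ab: "p a \<le> q b"
  proof (rule ccontr)
    assume "\<not> p a \<le> q b"
    then have "a \<in> {i\<in>A. q b < p i}"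
      using a by auto
    then have "0 < card {i\<in>A. q b < p i}"
      using Suc.prems(1) by (auto simp: card_gt_0_iff)
    moreover have "{j\<in>B. q b < q j} = {}"
      using b(2) by fastforce
    ultimately show False
      using Suc.prems(4)[of "q b"] by (metis card.empty not_le)
  qed
  \<comment> \<open>If \<open>t < p a\<close>, then also \<open>t < q b\<close> and both counts drop
    by exactly one; otherwise no \<open>p i\<close> exceeds \<open>t\<close>.\<close>
  have "card {i \<in> A - {a}. t < p i} \<le> card {j \<in> B - {b}. t < q j}" for t
  proof (cases "t < p a")
    case True
    have "{i \<in> A - {a}. t < p i} = {i\<in>A. t < p i} - {a}" "{j \<in> B - {b}. t < q j} = {j\<in>B. t < q j} - {b}"
      by auto
    then show ?thesis
      using True ab a(1) b(1) Suc.prems(1,2) Suc.prems(4)[of t] by (simp add: card_Diff_singleton)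
  next
    case False
    then have "{i \<in> A - {a}. t < p i} = {}"
      using a(2) by fastforce
    then show ?thesis
      by (metis card.empty le0)
  qed
  moreover have "k = card (A - {a})" "card (A - {a}) = card (B - {b})"
    using Suc.hyps(2) Suc.prems(1-3) a(1) b(1) by (simp_all add: card_Diff_singleton)
  ultimately obtain \<sigma> where \<sigma>: "bij_betw \<sigma> (A - {a}) (B - {b})" "\<forall>i\<in>A - {a}. p i \<le> q (\<sigma> i)"
    using Suc.hyps(1)[of "A - {a}" "B - {b}"] Suc.prems(1,2) by (meson finite_Diff)
  have "bij_betw (\<sigma>(a := b)) (A - {a}) (B - {b})"
    using \<sigma>(1) bij_betw_cong[of "A - {a}" "\<sigma>(a := b)" \<sigma> "B - {b}"] by simp
  then have "bij_betw (\<sigma>(a := b)) (insert a (A - {a})) (insert b (B - {b}))"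
    using notIn_Un_bij_betw[of a "A - {a}" "\<sigma>(a := b)" "B - {b}"] by simp
  then have "bij_betw (\<sigma>(a := b)) A B"
    using a(1) b(1) by (simp add: insert_absorb)
  then show ?case
    using \<sigma>(2) ab by (intro exI[of _ "\<sigma>(a := b)"]) auto
qed

text \<open>\<open>U\<close> carries column \<open>\<sigma> i\<close> of \<open>W\<close> to column
  \<open>i\<close> of \<open>V\<close>; the permutation matrix \<open>P\<close> does the renumbering
  in between.\<close>

lemma unitary_diag_permute:
  assumes V: "unitary_matrix V" and W: "unitary_matrix W" and \<sigma>: "bij \<sigma>"
  obtains U where "unitary_matrix U"
    "U ** unitary_diag W q ** ctranspose U = unitary_diag V (\<lambda>i. q (\<sigma> i))"
proof -
  define P :: "complex ^ 'a ^ 'a" where "P = (\<chi> k i. if k = \<sigma> i then 1 else 0)"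
  have inj: "\<sigma> i = \<sigma> j \<longleftrightarrow> i = j" for i j
    using \<sigma> by (auto simp: bij_def inj_def)
  have "(ctranspose P ** P) $ i $ j = (\<Sum>k\<in>UNIV. if k = \<sigma> i then (if i = j then 1 else 0) else 0)" for i j
    unfolding matrix_matrix_mult_def ctranspose_def vec_lambda_beta
    by (rule sum.cong) (auto simp: P_def inj)
  then have "ctranspose P ** P = mat 1"
    by (simp add: vec_eq_iff mat_def)
  then have P: "unitary_matrix P"
    by (rule unitary_matrixI)
  have PqP: "ctranspose P ** real_diag q ** P = real_diag (\<lambda>i. q (\<sigma> i))"
  proof -
    have "(ctranspose P ** (real_diag q ** P)) $ i $ j = real_diag (\<lambda>i. q (\<sigma> i)) $ i $ j" for i j
    proof -
      have "(ctranspose P ** (real_diag q ** P)) $ i $ j = (\<Sum>k\<in>UNIV. cnj (P $ k $ i) * (q k * P $ k $ j))"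
        by (subst matrix_matrix_mult_def) (simp add: real_diag_mult_left ctranspose_def)
      also have "\<dots> = (\<Sum>k\<in>UNIV. if k = \<sigma> i then (if i = j then complex_of_real (q k) else 0) else 0)"
        by (rule sum.cong) (auto simp: P_def inj)
      also have "\<dots> = real_diag (\<lambda>i. q (\<sigma> i)) $ i $ j"
        by (simp add: real_diag_def)
      finally show ?thesis .
    qed
    then show ?thesis
      by (simp add: vec_eq_iff matrix_mul_assoc)
  qed
  define U where "U = V ** (ctranspose P ** ctranspose W)"
  have "U ** unitary_diag W q ** ctranspose U
      = V ** (ctranspose P ** ((ctranspose W ** W) ** real_diag q ** (ctranspose W ** W)) ** P) ** ctranspose V"
    by (simp add: U_def unitary_diag_def ctranspose_mult matrix_mul_assoc)
  also have "\<dots> = unitary_diag V (\<lambda>i. q (\<sigma> i))"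
    using W by (simp add: unitary_matrix_def PqP unitary_diag_def)
  finally show thesis
    using that[of U] V W P by (simp add: U_def unitary_matrix_mult unitary_matrix_ctranspose)
qed

text \<open>The set is the span of the columns of \<open>W\<close> with index in \<open>S\<close>,
  being the image of a coordinate subspace under the injective \<open>W\<close>. The dimension is
  the complex one.\<close>

lemma
  fixes W :: "complex ^ 'n ^ 'n"
  assumes "unitary_matrix W"
  shows subspace_unitary_coordinates: "vec.subspace {x. \<forall>i. i \<notin> S \<longrightarrow> (ctranspose W *v x) $ i = 0}"
    and dim_unitary_coordinates: "vec.dim {x. \<forall>i. i \<notin> S \<longrightarrow> (ctranspose W *v x) $ i = 0} = card S"
proof -
  let ?E = "{x :: complex ^ 'n. \<forall>i. i \<notin> S \<longrightarrow> x $ i = 0}"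
  have WW: "ctranspose W *v (W *v x) = x" "W *v (ctranspose W *v x) = x" for x
    using assms by (simp_all add: matrix_vector_mul_assoc unitary_matrix_def)
  have eq: "{x. \<forall>i. i \<notin> S \<longrightarrow> (ctranspose W *v x) $ i = 0} = (*v) W ` ?E"
  proof (intro equalityI subsetI)
    fix x assume "x \<in> {x. \<forall>i. i \<notin> S \<longrightarrow> (ctranspose W *v x) $ i = 0}"
    then have "W *v (ctranspose W *v x) \<in> (*v) W ` ?E"
      by (intro imageI) simp
    then show "x \<in> (*v) W ` ?E"
      by (simp only: WW)
  qed (auto simp: WW)
  have "vec.subspace ?E"
    by (auto simp: vec.subspace_def)
  then show "vec.subspace {x. \<forall>i. i \<notin> S \<longrightarrow> (ctranspose W *v x) $ i = 0}"
    unfolding eq by (rule vec.subspace_image)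
  have "inj ((*v) W)"
    by (metis WW(1) injI)
  then have "vec.dim ((*v) W ` ?E) = vec.dim ?E"
    by (intro vec.dim_image_eq matrix_vector_mul_linear_gen) (auto intro: inj_on_subset)
  then show "vec.dim {x. \<forall>i. i \<notin> S \<longrightarrow> (ctranspose W *v x) $ i = 0} = card S"
    unfolding eq by (simp add: dim_substandard_cart)
qed

text \<open>A dimension count turns the bound on the quadratic form into the eigenvalue comparison
  \<open>#{i. t < p i} \<le> #{j. t < q j}\<close>, which replaces the minimax principle and needs no sorting.\<close>

lemma unitary_dominates:
  fixes V W :: "complex ^ 'n ^ 'n"
  assumes V: "unitary_matrix V" and W: "unitary_matrix W"
    and le: "\<And>t x. norm x = 1 \<Longrightarrow> (\<And>j. t < q j \<Longrightarrow> (ctranspose W *v x) $ j = 0) \<Longrightarrow>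
      x \<bullet> (unitary_diag V p *v x) \<le> t"
  obtains U where "unitary_matrix U" "psd_matrix (U ** unitary_diag W q ** ctranspose U - unitary_diag V p)"
proof -
  have "card {i. t < p i} \<le> card {j. t < q j}" for t
  proof (rule ccontr)
    assume *: "\<not> ?thesis"
    \<comment> \<open>\<open>S\<close> is spanned by the eigenvectors of the first matrix with
      eigenvalue above \<open>t\<close>, \<open>T\<close> by those of the second with eigenvalue at
      most \<open>t\<close>. If the count fails, their dimensions add up to more than that of the
      whole space, so they share a unit vector, at which the form of the first matrix is both above
      \<open>t\<close> and at most \<open>t\<close>.\<close>
    define S where "S = {x. \<forall>i. i \<notin> {i. t < p i} \<longrightarrow> (ctranspose V *v x) $ i = 0}"
    define T where "T = {x. \<forall>j. j \<notin> - {j. t < q j} \<longrightarrow> (ctranspose W *v x) $ j = 0}"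
    have "vec.dim {x + y |x y. x \<in> S \<and> y \<in> T} \<le> CARD('n)"
      by (rule dim_subset_UNIV_cart_gen)
    moreover have "vec.dim {x + y |x y. x \<in> S \<and> y \<in> T} + vec.dim (S \<inter> T) = vec.dim S + vec.dim T"
      unfolding S_def T_def using V W by (intro vec.dim_sums_Int subspace_unitary_coordinates)
    moreover have "card (- X) = CARD('n) - card X" for X :: "'n set"
      by (simp add: Compl_eq_Diff_UNIV card_Diff_subset)
    then have "vec.dim S = card {i. t < p i}" "vec.dim T = CARD('n) - card {j. t < q j}"
      unfolding S_def T_def using V W by (simp_all only: dim_unitary_coordinates)
    moreover have "card {j. t < q j} \<le> CARD('n)"
      by (rule card_mono) auto
    ultimately have "vec.dim (S \<inter> T) \<noteq> 0"
      using * by linarith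
    then obtain y where y: "y \<in> S" "y \<in> T" "y \<noteq> 0"
      by (auto simp: vec.dim_eq_0)
    define x where "x = (1 / norm y) *\<^sub>R y"
    have x: "norm x = 1"
      using y by (simp add: x_def)
    have "x \<bullet> (unitary_diag V p *v x) \<le> t"
      using y by (intro le x) (auto simp: T_def x_def matrix_vector_mult_scaleR_complex)
    moreover have "t < x \<bullet> (unitary_diag V p *v x)"
    proof -
      \<comment> \<open>These weights sum to 1 and vanish unless \<open>t < p i\<close>, so the
        weighted mean of the eigenvalues exceeds \<open>t\<close> strictly.\<close>
      define a where "a i = (cmod ((ctranspose V *v x) $ i))\<^sup>2" for i
      have sum: "sum a UNIV = 1"
        using unitary_coordinates_power2_norm[OF V, of x] x by (simp add: a_def)
      have a0: "a i = 0" if "\<not> t < p i" for i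
        using y that by (auto simp: S_def a_def x_def matrix_vector_mult_scaleR_complex)
      have "\<exists>i. a i \<noteq> 0"
        using sum by (metis sum.neutral zero_neq_one)
      then obtain i where i: "a i > 0"
        by (auto simp: a_def)
      have "(\<Sum>i\<in>UNIV. a i * t) < (\<Sum>i\<in>UNIV. a i * p i)"
      proof (rule sum_strict_mono_ex1)
        show "\<forall>i\<in>UNIV. a i * t \<le> a i * p i"
          using a0 by (metis a_def mult_left_mono mult_zero_left order.refl zero_le_power2 less_imp_le)
        have "t < p i"
          using i a0[of i] by auto
        then show "\<exists>i\<in>UNIV. a i * t < a i * p i"
          using i by (intro bexI[of _ i]) auto
      qed simp
      then show ?thesis
        using sum by (simp add: inner_unitary_diag a_def flip: sum_distrib_right)
    qed
    ultimately show False
      by simp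
  qed
  then obtain \<sigma> where \<sigma>: "bij \<sigma>" "\<And>i. p i \<le> q (\<sigma> i)"
    using bij_betw_of_card_superlevel_le[of UNIV UNIV p q] by auto
  obtain U where "unitary_matrix U" "U ** unitary_diag W q ** ctranspose U = unitary_diag V (\<lambda>i. q (\<sigma> i))"
    using unitary_diag_permute[OF V W \<sigma>(1)] .
  \<comment> \<open>The columns of \<open>V\<close> now diagonalize both matrices, and the
    difference has the eigenvalues \<open>q (\<sigma> i) - p i\<close>.\<close>
  then show thesis
    using that[of U] \<sigma>(2) V by (simp add: unitary_diag_diff psd_unitary_diag_iff)
qed

section \<open>Jensen's inequality and compression by contractions\<close>

text \<open>Jensen's inequality is applied to the normalized weights; the missing mass
  \<open>1 - sum a I\<close> is then put at the point 0, where \<open>f\<close> is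
  nonnegative.\<close>

lemma concave_on_sum_le:
  fixes f :: "real \<Rightarrow> real"
  assumes f: "concave_on {0..} f" "0 \<le> f 0" and I: "finite I"
    and a: "\<And>i. i \<in> I \<Longrightarrow> 0 \<le> a i" "sum a I \<le> 1" and m: "\<And>i. i \<in> I \<Longrightarrow> 0 \<le> m i"
  shows "(\<Sum>i\<in>I. a i * f (m i)) \<le> f (\<Sum>i\<in>I. a i * m i)"
proof (cases "sum a I = 0")
  case True
  then have "a i = 0" if "i \<in> I" for i
    using that a(1) I by (simp add: sum_nonneg_eq_0_iff)
  then show ?thesis
    using f(2) by simp
next
  case False
  define s where "s = sum a I"
  have s: "0 < s" "s \<le> 1"
    using False a sum_nonneg[of I a] by (auto simp: s_def)
  define y where "y = (\<Sum>i\<in>I. (a i / s) *\<^sub>R m i)"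
  have "I \<noteq> {}"
    using False by auto
  then have "(\<Sum>i\<in>I. (a i / s) * f (m i)) \<le> f y"
    unfolding y_def using f(1) I a(1) m s
    by (intro concave_on_sum[where C = "{0..}"]) (auto simp: s_def simp flip: sum_divide_distrib)
  then have "s * (\<Sum>i\<in>I. (a i / s) * f (m i)) \<le> s * f y"
    using s by (intro mult_left_mono) auto
  also have "\<dots> \<le> s * f y + (1 - s) * f 0"
    using s f(2) by simp
  also have "\<dots> \<le> f (s * y)"
  proof -
    have "0 \<le> y"
      unfolding y_def using a(1) m s by (intro sum_nonneg) auto
    then show ?thesis
      using concave_onD[OF f(1), of s 0 y] s by simp
  qed
  finally show ?thesis
    using s by (simp add: y_def sum_distrib_left)
qed

text \<open>Among the points of nonzero weight, one is at least the mean and one is at most the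
  mean. An increasing \<open>f\<close> is bounded through the former, a decreasing \<open>f\<close>
  through the latter.\<close>

lemma monotone_convex_combination_le:
  fixes f :: "real \<Rightarrow> real" and a d :: "'a::finite \<Rightarrow> real"
  assumes f: "mono_on {0..} f \<or> antimono_on {0..} f"
    and a: "\<And>i. 0 \<le> a i" "sum a UNIV = 1" and d: "\<And>i. 0 \<le> d i"
    and t: "\<And>i. a i \<noteq> 0 \<Longrightarrow> f (d i) \<le> t"
  shows "f (\<Sum>i\<in>UNIV. a i * d i) \<le> t"
proof -
  define y where "y = (\<Sum>i\<in>UNIV. a i * d i)"
  have y0: "0 \<le> y"
    unfolding y_def using a d by (intro sum_nonneg) auto
  have avg: "(\<Sum>i\<in>UNIV. a i * (d i - y)) = 0"
    using a(2) by (simp add: y_def right_diff_distrib sum_subtractf flip: sum_distrib_right)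
  obtain k where k: "a k \<noteq> 0"
    using a(2) by (metis sum.neutral zero_neq_one)
  have upper: "\<exists>i. a i \<noteq> 0 \<and> y \<le> d i"
  proof (rule ccontr)
    assume *: "\<not> ?thesis"
    have "(\<Sum>i\<in>UNIV. a i * (d i - y)) < (\<Sum>i\<in>(UNIV :: 'a set). 0)"
    proof (rule sum_strict_mono_ex1)
      show "\<forall>i\<in>UNIV. a i * (d i - y) \<le> 0"
        using a(1) * by (metis diff_le_0_iff_le linear mult_nonneg_nonpos mult_zero_left order.refl)
      show "\<exists>i\<in>UNIV. a i * (d i - y) < 0"
        using a(1)[of k] k * by (intro bexI[of _ k]) (auto simp: mult_less_0_iff)
    qed simp
    then show False
      using avg by simp
  qed
  have lower: "\<exists>i. a i \<noteq> 0 \<and> d i \<le> y"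
  proof (rule ccontr)
    assume *: "\<not> ?thesis"
    have "(\<Sum>i\<in>(UNIV :: 'a set). 0) < (\<Sum>i\<in>UNIV. a i * (d i - y))"
    proof (rule sum_strict_mono_ex1)
      show "\<forall>i\<in>UNIV. 0 \<le> a i * (d i - y)"
        using a(1) * by (metis diff_ge_0_iff_ge linear mult_nonneg_nonneg mult_zero_left order.refl)
      show "\<exists>i\<in>UNIV. 0 < a i * (d i - y)"
        using a(1)[of k] k * by (intro bexI[of _ k]) (auto simp: zero_less_mult_iff)
    qed simp
    then show False
      using avg by simp
  qed
  from f have "f y \<le> t"
  proof
    assume "mono_on {0..} f"
    then show ?thesis
      using upper y0 d t by (fastforce dest: monotone_onD)
  next
    assume "antimono_on {0..} f"
    then show ?thesis
      using lower y0 d t by (fastforce dest: monotone_onD)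
  qed
  then show ?thesis
    by (simp add: y_def)
qed

text \<open>Let \<open>M = unitary_diag R m\<close>. For a unit vector \<open>x\<close> in the span
  of the eigenvectors with \<open>f (d j) \<le> t\<close>, Jensen bounds the form of
  \<open>X f(M) X*\<close> at \<open>x\<close> by \<open>f\<close> of the form of
  \<open>X M X*\<close>. The latter form is a mean of such \<open>d j\<close>, so monotonicity gives
  the bound \<open>t\<close>, and counting dimensions yields \<open>U\<close>.\<close>

lemma contraction_compression_le:
  fixes X R W :: "complex ^ 'n ^ 'n"
  assumes f: "mono_on {0..} f \<or> antimono_on {0..} f" "concave_on {0..} f" "0 \<le> f 0"
    and R: "unitary_matrix R" "\<And>i. 0 \<le> m i"
    and W: "unitary_matrix W" "\<And>i. 0 \<le> d i"
    and eq: "X ** unitary_diag R m ** ctranspose X = unitary_diag W d"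
    and contr: "\<And>x. norm (ctranspose X *v x) \<le> norm x"
  obtains U where "unitary_matrix U"
    "psd_matrix (U ** unitary_diag W (\<lambda>i. f (d i)) ** ctranspose U
       - X ** unitary_diag R (\<lambda>i. f (m i)) ** ctranspose X)"
proof -
  let ?P = "X ** unitary_diag R (\<lambda>i. f (m i)) ** ctranspose X"
  have form: "x \<bullet> (X ** M ** ctranspose X *v x) = (ctranspose X *v x) \<bullet> (M *v (ctranspose X *v x))" for M x
    by (simp add: inner_adjoint[of _ X] flip: matrix_vector_mul_assoc)
  have "ctranspose ?P = ?P"
    by (simp add: ctranspose_mult matrix_mul_assoc)
  then obtain V p where V: "unitary_matrix V" and P: "?P = unitary_diag V p"
    using spectral_theorem by blast
  have "x \<bullet> (unitary_diag V p *v x) \<le> t"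
    if x: "norm x = 1" and supp: "\<And>j. t < f (d j) \<Longrightarrow> (ctranspose W *v x) $ j = 0" for t x
  proof -
    define g where "g = ctranspose X *v x"
    define a where "a i = (cmod ((ctranspose W *v x) $ i))\<^sup>2" for i
    define b where "b i = (cmod ((ctranspose R *v g) $ i))\<^sup>2" for i
    \<comment> \<open>A contraction may shrink \<open>x\<close>, so these weights can have total
      less than 1; Jensen's inequality still applies because \<open>f 0\<close> is
      nonnegative.\<close>
    have "sum b UNIV = (norm g)\<^sup>2"
      using unitary_coordinates_power2_norm[OF R(1)] by (simp add: b_def)
    also have "\<dots> \<le> 1"
      using contr[of x] x by (simp add: g_def power_le_one)
    finally have b: "sum b UNIV \<le> 1" .
    have "x \<bullet> (unitary_diag V p *v x) = (\<Sum>i\<in>UNIV. b i * f (m i))"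
      by (simp add: form inner_unitary_diag b_def g_def flip: P)
    also have "\<dots> \<le> f (\<Sum>i\<in>UNIV. b i * m i)"
      using f b R(2) by (intro concave_on_sum_le) (auto simp: b_def)
    also have "(\<Sum>i\<in>UNIV. b i * m i) = x \<bullet> (unitary_diag W d *v x)"
      by (simp add: form inner_unitary_diag b_def g_def flip: eq)
    also have "\<dots> = (\<Sum>i\<in>UNIV. a i * d i)"
      by (simp add: inner_unitary_diag a_def)
    also have "f \<dots> \<le> t"
    proof (rule monotone_convex_combination_le[OF f(1)])
      show "sum a UNIV = 1"
        using unitary_coordinates_power2_norm[OF W(1), of x] x by (simp add: a_def)
      show "f (d i) \<le> t" if "a i \<noteq> 0" for i
        using supp[of i] that by (force simp: a_def)
    qed (use W(2) in \<open>auto simp: a_def\<close>)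
    finally show ?thesis .
  qed
  from unitary_dominates[OF V W(1) this] P that show thesis
    by metis
qed

section \<open>Unitary equivalence of \<open>T* T\<close> and \<open>T T*\<close>\<close>

text \<open>\<open>T\<close> maps orthogonal eigenvectors of \<open>T* T\<close> with
  \<open>p i > 0\<close> to orthogonal eigenvectors of \<open>T T*\<close> with the same
  eigenvalues. The normalized images are completed to an eigenbasis of \<open>T T*\<close>, in which
  the added vectors have eigenvalue 0; the unitary matches the two eigenbases.\<close>

lemma ctranspose_mult_self_unitarily_equivalent:
  fixes T :: "complex ^ 'n ^ 'n"
  obtains U where "unitary_matrix U"
    "ctranspose T ** T = U ** (T ** ctranspose T) ** ctranspose U"
proof -
  have herm: "ctranspose (T ** ctranspose T) = T ** ctranspose T" "ctranspose (ctranspose T ** T) = ctranspose T ** T"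
    by (simp_all add: ctranspose_mult)
  obtain V p where V: "unitary_matrix V" and TT: "ctranspose T ** T = unitary_diag V p"
    using spectral_theorem[OF herm(2)] .
  have "psd_matrix (ctranspose T ** T)"
    using herm(2) by (simp add: psd_matrix_iff inner_adjoint[of _ "ctranspose T"] flip: matrix_vector_mul_assoc)
  then have p: "0 \<le> p i" for i
    using V TT by (simp add: psd_unitary_diag_iff)
  define v where "v i = V *v axis i 1" for i
  have v: "cinner (v i) (v j) = (if i = j then 1 else 0)" for i j
    unfolding v_def using V by (rule cinner_unitary_columns)
  have ev: "ctranspose T *v (T *v v i) = p i *\<^sub>R v i" for i
    using unitary_diag_eigenvector[OF V, of p i] by (simp add: v_def flip: TT matrix_vector_mul_assoc)
  have Tv: "cinner (T *v v i) (T *v v j) = (if i = j then complex_of_real (p j) else 0)" for i j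
    using cinner_adjoint[of "v i" "ctranspose T" "T *v v j"]
    by (auto simp: ev cinner_scaleR_right v scaleR_conv_of_real[where 'a = complex] split: if_splits)
  \<comment> \<open>The norm of \<open>T *v v i\<close> is \<open>sqrt (p i)\<close>. Where
    \<open>p i = 0\<close> the result is the zero vector; the family is taken over \<open>S\<close>
    only.\<close>
  define u where "u i = (1 / sqrt (p i)) *\<^sub>R (T *v v i)" for i
  define S where "S = {i. 0 < p i}"
  have u: "cinner (u i) (u j) = (if i = j then 1 else 0)" if "i \<in> S" "j \<in> S" for i j
    using that by (auto simp: S_def u_def cinner_scaleR_left cinner_scaleR_right Tv scaleR_conv_of_real[where 'a = complex]
        simp flip: of_real_mult)
  have eig: "(T ** ctranspose T) *v u i = p i *\<^sub>R u i" if "i \<in> S" for i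
    by (simp add: u_def matrix_vector_mult_scaleR_complex ev flip: matrix_vector_mul_assoc)
  obtain w e where w: "\<And>i j. cinner (w i) (w j) = (if i = j then 1 else 0)"
    and we: "\<And>i. (T ** ctranspose T) *v w i = e i *\<^sub>R w i"
    and wu: "\<And>i. i \<in> S \<Longrightarrow> w i = u i \<and> e i = p i"
    using hermitian_eigenfamily_extend[OF herm(1), of S u p] u eig by blast
  \<comment> \<open>An added vector is orthogonal to every \<open>T *v v j\<close>, hence to the
    range of \<open>T\<close>, so \<open>ctranspose T\<close> annihilates it.\<close>
  have "e i = p i" for i
  proof (cases "i \<in> S")
    case False
    then have p0: "p i = 0"
      using p[of i] by (simp add: S_def)
    have "cinner (T *v v j) (w i) = 0" for j
    proof (cases "j \<in> S")
      case True
      then have "T *v v j = sqrt (p j) *\<^sub>R w j"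
        using wu[of j] by (simp add: u_def S_def)
      then show ?thesis
        using True False w[of j i] by (auto simp: cinner_scaleR_left)
    next
      case False
      then have "p j = 0"
        using p[of j] by (simp add: S_def)
      then have "T *v v j = 0"
        using Tv[of j j] by (simp add: cinner_self)
      then show ?thesis
        by simp
    qed
    then have "cinner (v j) (ctranspose T *v w i) = 0" for j
      by (simp add: cinner_adjoint)
    then have "ctranspose V *v (ctranspose T *v w i) = 0"
      by (simp add: vec_eq_iff v_def cinner_def matrix_vector_mult_def ctranspose_def axis_def
          if_distrib cong: if_cong)
    then have "(V ** ctranspose V) *v (ctranspose T *v w i) = 0"
      by (simp flip: matrix_vector_mul_assoc)
    then have "ctranspose T *v w i = 0"
      using V by (simp add: unitary_matrix_def)
    then have "e i *\<^sub>R w i = 0"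
      by (simp flip: we matrix_vector_mul_assoc)
    moreover have "w i \<noteq> 0"
      using w[of i i] by auto
    ultimately show ?thesis
      using p0 by simp
  qed (simp add: wu)
  then have "e = p"
    by auto
  define W where "W = (\<chi> k j. w j $ k)"
  have W: "unitary_matrix W" "T ** ctranspose T = unitary_diag W p"
    unfolding W_def using unitary_diag_of_eigenbasis[of w, OF w we] by (simp_all add: \<open>e = p\<close>)
  let ?U = "V ** ctranspose W"
  have "?U ** unitary_diag W p ** ctranspose ?U
      = V ** ((ctranspose W ** W) ** real_diag p ** (ctranspose W ** W)) ** ctranspose V"
    by (simp add: unitary_diag_def ctranspose_mult matrix_mul_assoc)
  also have "\<dots> = unitary_diag V p"
    using W(1) by (simp add: unitary_matrix_def unitary_diag_def)
  finally show thesis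
    using that[of ?U] V W TT by (simp add: unitary_matrix_mult unitary_matrix_ctranspose)
qed

section \<open>Subadditivity for functions vanishing at 0\<close>

text \<open>This treats one summand. It is stated for any \<open>A\<close> below
  \<open>C = unitary_diag W c\<close>, so that it serves \<open>A\<close> and \<open>B\<close> with
  the same \<open>D\<close> and \<open>\<epsilon>\<close>. Here \<open>D\<close> is the product of
  \<open>S\<close> and \<open>E\<close>, where \<open>E\<close> is the matrix called
  \<open>D\<close> in the overview.\<close>

lemma congruence_by_pseudo_inverse_le:
  fixes A W :: "complex ^ 'n ^ 'n"
  assumes f: "mono_on {0..} f \<or> antimono_on {0..} f" "concave_on {0..} f" "f 0 = 0"
    and sgn: "\<And>x. 0 \<le> x \<Longrightarrow> f x = \<epsilon> * \<bar>f x\<bar>"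
    and A: "psd_matrix A"
    and W: "unitary_matrix W" "\<And>i. 0 \<le> c i"
    and AC: "psd_matrix (unitary_diag W c - A)"
  defines "D \<equiv> unitary_diag W (\<lambda>i. sqrt \<bar>f (c i)\<bar> / sqrt (c i))"
  obtains U where "unitary_matrix U"
    "psd_matrix (U ** matrix_fun f A ** ctranspose U - \<epsilon> *\<^sub>R (D ** A ** D))"
proof -
  obtain Q a where Q: "unitary_matrix Q" and AQ: "A = unitary_diag Q a" and a: "\<And>i. 0 \<le> a i"
    using psd_matrix_unitary_diag[OF A] by blast
  define C where "C = unitary_diag W c"
  define R where "R = unitary_diag Q (\<lambda>i. sqrt (a i))"
  \<comment> \<open>Since division by zero gives zero, this is the square root of the pseudo-inverse
    of \<open>C\<close>. Below, \<open>P\<close> and \<open>N\<close> are the projections onto the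
    range and the kernel of \<open>C\<close>.\<close>
  define E where "E = unitary_diag W (\<lambda>i. 1 / sqrt (c i))"
  define S where "S = unitary_diag W (\<lambda>i. sqrt \<bar>f (c i)\<bar>)"
  define P where "P = unitary_diag W (\<lambda>i. if c i = 0 then 0 else 1)"
  define N where "N = unitary_diag W (\<lambda>i. if c i = 0 then 1 else 0)"
  define X where "X = R ** E"
  have RR: "R ** R = A"
    using Q a by (simp add: R_def AQ unitary_diag_mult)
  have herm: "ctranspose R = R" "ctranspose E = E" "ctranspose S = S"
    "ctranspose X = E ** R"
    by (simp_all add: R_def E_def S_def X_def ctranspose_mult)
  have ECE: "E ** C ** E = P"
    unfolding E_def C_def P_def using W
    by (auto simp: unitary_diag_mult intro!: arg_cong[where f = "unitary_diag W"])
  have ES: "E ** S = D" "S ** E = D"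
    unfolding E_def S_def D_def using W by (simp_all add: unitary_diag_mult)
  have le_C: "x \<bullet> (A *v x) \<le> x \<bullet> (C *v x)" for x
    using AC by (simp add: psd_matrix_iff C_def matrix_vector_mult_diff_rdistrib inner_diff_right)
  have R_norm: "(norm (R *v x))\<^sup>2 = x \<bullet> (A *v x)" for x
    by (simp add: power2_norm_eq_inner inner_adjoint herm flip: RR matrix_vector_mul_assoc)
  \<comment> \<open>From \<open>0 \<le> A \<le> C\<close> the form of \<open>A\<close> vanishes on
    the kernel of \<open>C\<close>, so \<open>R\<close> is zero there. Hence
    \<open>R ** P = R\<close>, and compressing \<open>C\<close> by \<open>X\<close> gives back
    exactly \<open>A\<close>.\<close>
  have "R ** N = 0"
  proof -
    have CN: "C ** N = 0"
      unfolding C_def N_def using W unitary_diag_scaleR[of W 0 "\<lambda>_. 0"]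
      by (simp add: unitary_diag_mult if_distrib cong: if_cong)
    have "(norm (R *v (N *v x)))\<^sup>2 \<le> 0" for x
      using le_C[of "N *v x"] by (simp add: R_norm matrix_vector_mul_assoc[of C] CN)
    then have "R *v (N *v x) = 0" for x
      by simp
    then show ?thesis
      by (simp add: matrix_eq matrix_vector_mul_assoc)
  qed
  moreover have PN: "P + N = mat 1"
    unfolding P_def N_def using unitary_diag_const[OF W(1), of 1]
    by (simp add: unitary_diag_add if_distrib cong: if_cong)
  then have "R ** P + R ** N = R"
    by (simp flip: matrix_add_ldistrib)
  ultimately have RP: "R ** P = R"
    by simp
  have XCX: "X ** C ** ctranspose X = unitary_diag Q a"
  proof -
    have "X ** C ** ctranspose X = R ** (E ** C ** E) ** R"
      by (simp add: X_def herm matrix_mul_assoc ctranspose_mult)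
    then show ?thesis
      by (simp add: ECE RP RR AQ)
  qed
  \<comment> \<open>\<open>X* X = E A E \<le> E C E = P\<close>, and \<open>P\<close> is a
    projection.\<close>
  have X_contr: "norm (X *v x) \<le> norm x" for x
  proof -
    have "(norm (X *v x))\<^sup>2 = (E *v x) \<bullet> (A *v (E *v x))"
      by (simp add: X_def R_norm flip: matrix_vector_mul_assoc)
    also have "\<dots> \<le> (E *v x) \<bullet> (C *v (E *v x))"
      by (rule le_C)
    also have "\<dots> = x \<bullet> (P *v x)"
      by (simp add: inner_adjoint[of x E] herm flip: ECE matrix_vector_mul_assoc)
    also have "\<dots> \<le> x \<bullet> (P *v x) + x \<bullet> (N *v x)"
      by (simp add: N_def inner_unitary_diag sum_nonneg)
    also have "\<dots> = (norm x)\<^sup>2"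
      by (simp add: PN power2_norm_eq_inner flip: inner_add_right matrix_vector_mult_add_rdistrib)
    finally show ?thesis
      by (rule power2_le_imp_le) simp
  qed
  \<comment> \<open>The compression uses the adjoint of \<open>X\<close>; Cauchy-Schwarz carries the
    bound over from \<open>X\<close>.\<close>
  have X_contr': "norm (ctranspose X *v x) \<le> norm x" for x
  proof (cases "ctranspose X *v x = 0")
    case False
    have "norm (ctranspose X *v x) * norm (ctranspose X *v x) = x \<bullet> (X *v (ctranspose X *v x))"
      by (simp add: inner_adjoint[of x X] power2_norm_eq_inner flip: power2_eq_square)
    also have "\<dots> \<le> norm x * norm (X *v (ctranspose X *v x))"
      by (rule norm_cauchy_schwarz)
    also have "\<dots> \<le> norm x * norm (ctranspose X *v x)"
      by (intro mult_left_mono X_contr) simp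
    finally show ?thesis
      using False by simp
  qed simp
  obtain U1 where U1: "unitary_matrix U1"
    "psd_matrix (U1 ** unitary_diag Q (\<lambda>i. f (a i)) ** ctranspose U1
       - X ** unitary_diag W (\<lambda>i. f (c i)) ** ctranspose X)"
    by (rule contraction_compression_le[OF f(1,2) _ W Q a XCX[unfolded C_def] X_contr']) (use f(3) in auto)
  define T where "T = X ** S"
  have T: "ctranspose T ** T = D ** A ** D"
  proof -
    have "ctranspose T ** T = (S ** E) ** (R ** R) ** (E ** S)"
      by (simp add: T_def X_def ctranspose_mult herm matrix_mul_assoc)
    then show ?thesis
      by (simp add: ES RR)
  qed
  \<comment> \<open>\<open>S ** S\<close> is \<open>\<bar>f\<bar>(C)\<close>, and the factor
    \<open>\<epsilon>\<close> restores the sign of \<open>f\<close>.\<close>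
  have T': "\<epsilon> *\<^sub>R (T ** ctranspose T) = X ** unitary_diag W (\<lambda>i. f (c i)) ** ctranspose X"
  proof -
    have "\<epsilon> *\<^sub>R (T ** ctranspose T) = X ** (\<epsilon> *\<^sub>R (S ** S)) ** ctranspose X"
      by (simp add: T_def ctranspose_mult herm(3) matrix_mul_assoc matrix_scalar_ac scalar_matrix_assoc)
    moreover have "\<epsilon> *\<^sub>R (S ** S) = unitary_diag W (\<lambda>i. f (c i))"
      using W sgn[symmetric] by (simp add: S_def unitary_diag_mult flip: unitary_diag_scaleR)
    ultimately show ?thesis
      by simp
  qed
  obtain U2 where U2: "unitary_matrix U2" "D ** A ** D = U2 ** (T ** ctranspose T) ** ctranspose U2"
    using ctranspose_mult_self_unitarily_equivalent[of T] T by metis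
  let ?F = "unitary_diag Q (\<lambda>i. f (a i))"
  \<comment> \<open>\<open>U1\<close> gives the bound for \<open>\<epsilon> T T*\<close>;
    conjugating by \<open>U2\<close> replaces \<open>T T*\<close> by \<open>D A D\<close>.\<close>
  have "psd_matrix (U2 ** (U1 ** ?F ** ctranspose U1 - \<epsilon> *\<^sub>R (T ** ctranspose T)) ** ctranspose U2)"
    using psd_matrix_congruence[OF U1(2)] T' by simp
  also have "U2 ** (U1 ** ?F ** ctranspose U1 - \<epsilon> *\<^sub>R (T ** ctranspose T)) ** ctranspose U2
      = (U2 ** U1) ** matrix_fun f A ** ctranspose (U2 ** U1) - \<epsilon> *\<^sub>R (D ** A ** D)"
  proof -
    have "U2 ** (\<epsilon> *\<^sub>R (T ** ctranspose T)) ** ctranspose U2 = \<epsilon> *\<^sub>R (D ** A ** D)"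
      by (simp add: U2(2) matrix_scalar_ac flip: scalar_matrix_assoc)
    moreover have "?F = matrix_fun f A"
      by (simp add: AQ matrix_fun_unitary_diag[OF Q])
    ultimately show ?thesis
      by (simp add: matrix_mult_diff_left matrix_mult_diff_right ctranspose_mult matrix_mul_assoc)
  qed
  finally show thesis
    using that U1(1) U2(1) by (meson unitary_matrix_mult)
qed

text \<open>The bounds for \<open>\<epsilon> D A D\<close> and \<open>\<epsilon> D B D\<close> are
  added. Since \<open>D\<close> and \<open>A + B\<close> share the eigenbasis \<open>W\<close>, the
  sum \<open>\<epsilon> D (A + B) D\<close> can be computed on eigenvalues and equals
  \<open>f(A + B)\<close>.\<close>

lemma matrix_fun_subadditive_of_zero_at_zero:
  fixes A B :: "complex ^ 'n ^ 'n"
  assumes f: "mono_on {0..} f \<or> antimono_on {0..} f" "concave_on {0..} f" "f 0 = 0"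
    and A: "psd_matrix A" and B: "psd_matrix B"
  obtains U V where "unitary_matrix U" "unitary_matrix V"
    "psd_matrix (U ** matrix_fun f A ** ctranspose U + V ** matrix_fun f B ** ctranspose V
       - matrix_fun f (A + B))"
proof -
  obtain W c where W: "unitary_matrix W" and ABW: "A + B = unitary_diag W c" and c: "\<And>i. 0 \<le> c i"
    using psd_matrix_unitary_diag[OF psd_matrix_add[OF A B]] by blast
  \<comment> \<open>With \<open>f 0 = 0\<close>, monotonicity in either direction fixes the sign of
    \<open>f\<close>.\<close>
  have "\<exists>\<epsilon>. \<forall>x\<ge>0. f x = \<epsilon> * \<bar>f x\<bar>"
    using f(1)
  proof
    assume "mono_on {0..} f"
    then have "\<forall>x\<ge>0. f x = 1 * \<bar>f x\<bar>"
      using f(3) by (auto dest: monotone_onD[of "{0..}" _ _ f 0])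
    then show ?thesis ..
  next
    assume "antimono_on {0..} f"
    then have "\<forall>x\<ge>0. f x = (- 1) * \<bar>f x\<bar>"
      using f(3) by (auto dest: monotone_onD[of "{0..}" _ _ f 0])
    then show ?thesis ..
  qed
  then obtain \<epsilon> where sgn: "\<And>x. 0 \<le> x \<Longrightarrow> f x = \<epsilon> * \<bar>f x\<bar>"
    by blast
  define D where "D = unitary_diag W (\<lambda>i. sqrt \<bar>f (c i)\<bar> / sqrt (c i))"
  \<comment> \<open>The two differences are \<open>B\<close> and \<open>A\<close>.\<close>
  have AC: "psd_matrix (unitary_diag W c - A)" and BC: "psd_matrix (unitary_diag W c - B)"
    using A B by (simp_all flip: ABW)
  obtain U where U: "unitary_matrix U" "psd_matrix (U ** matrix_fun f A ** ctranspose U - \<epsilon> *\<^sub>R (D ** A ** D))"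
    using congruence_by_pseudo_inverse_le[OF f sgn A W c AC] unfolding D_def by blast
  obtain V where V: "unitary_matrix V" "psd_matrix (V ** matrix_fun f B ** ctranspose V - \<epsilon> *\<^sub>R (D ** B ** D))"
    using congruence_by_pseudo_inverse_le[OF f sgn B W c BC] unfolding D_def by blast
  have "\<epsilon> *\<^sub>R (D ** A ** D) + \<epsilon> *\<^sub>R (D ** B ** D) = \<epsilon> *\<^sub>R (D ** (A + B) ** D)"
    by (simp add: matrix_add_ldistrib matrix_mult_add_left scaleR_add_right)
  also have "\<dots> = unitary_diag W (\<lambda>i. f (c i))"
  proof -
    \<comment> \<open>On the kernel of \<open>A + B\<close> the left side is 0, and
      \<open>f 0 = 0\<close> makes the right side agree.\<close>
    have "\<epsilon> * (sqrt \<bar>f (c i)\<bar> / sqrt (c i) * c i * (sqrt \<bar>f (c i)\<bar> / sqrt (c i))) = f (c i)" for i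
    proof (cases "c i = 0")
      case False
      have "\<epsilon> * (sqrt \<bar>f (c i)\<bar> / sqrt (c i) * c i * (sqrt \<bar>f (c i)\<bar> / sqrt (c i)))
          = \<epsilon> * ((sqrt \<bar>f (c i)\<bar> * sqrt \<bar>f (c i)\<bar>) * (c i / (sqrt (c i) * sqrt (c i))))"
        by simp
      also have "\<dots> = \<epsilon> * \<bar>f (c i)\<bar>"
        using False c[of i] by simp
      finally show ?thesis
        using sgn[OF c[of i]] by simp
    qed (simp add: f(3))
    then show ?thesis
      using W by (simp add: D_def ABW unitary_diag_mult flip: unitary_diag_scaleR)
  qed
  also have "\<dots> = matrix_fun f (A + B)"
    by (simp add: ABW matrix_fun_unitary_diag[OF W])
  finally have "matrix_fun f (A + B) = \<epsilon> *\<^sub>R (D ** A ** D) + \<epsilon> *\<^sub>R (D ** B ** D)"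
    by simp
  then show thesis
    using that[OF U(1) V(1)] psd_matrix_add[OF U(2) V(2)] by (simp add: algebra_simps)
qed

section \<open>Constant shifts and the general case\<close>

lemma matrix_fun_add_const:
  assumes "psd_matrix A"
  shows "matrix_fun (\<lambda>x. f x + k) A = matrix_fun f A + k *\<^sub>R mat 1"
proof -
  obtain W d where W: "unitary_matrix W" and A: "A = unitary_diag W d"
    using psd_matrix_unitary_diag[OF assms] by blast
  then show ?thesis
    by (simp add: matrix_fun_unitary_diag unitary_diag_add flip: unitary_diag_const[OF W])
qed

lemma hermitian_matrix_fun:
  assumes "psd_matrix A"
  shows "ctranspose (matrix_fun f A) = matrix_fun f A"
  using psd_matrix_unitary_diag[OF assms] by (metis matrix_fun_unitary_diag ctranspose_unitary_diag)

theorem theorem3p1: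
  fixes f :: "real \<Rightarrow> real" and A B :: "complex ^ 'n ^ 'n"
  assumes "mono_on {0..} f \<or> antimono_on {0..} f"
    and "concave_on {0..} f"
    and "f 0 \<ge> 0"
    and "psd_matrix A" and "psd_matrix B"
  shows "\<exists>U V. unitary_matrix U \<and> unitary_matrix V \<and>
           matrix_fun f (A + B) \<le>\<^sub>L
             U ** matrix_fun f A ** ctranspose U + V ** matrix_fun f B ** ctranspose V"
proof -
  define g where "g x = f x - f 0" for x
  have "mono_on {0..} g \<or> antimono_on {0..} g"
    using assms(1) by (auto simp: g_def monotone_on_def)
  moreover have "concave_on {0..} g"
    unfolding g_def using assms(2) by (intro concave_on_diff) (auto simp: convex_on_const)
  moreover have "g 0 = 0"
    by (simp add: g_def)
  ultimately obtain U V where U: "unitary_matrix U" and V: "unitary_matrix V"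
    and psd: "psd_matrix (U ** matrix_fun g A ** ctranspose U + V ** matrix_fun g B ** ctranspose V
       - matrix_fun g (A + B))"
    using matrix_fun_subadditive_of_zero_at_zero[OF _ _ _ assms(4,5)] by metis
  have AB: "psd_matrix (A + B)"
    using assms(4,5) by (rule psd_matrix_add)
  have f: "matrix_fun f M = matrix_fun g M + f 0 *\<^sub>R mat 1" if "psd_matrix M" for M :: "complex ^ 'n ^ 'n"
    using matrix_fun_add_const[OF that, of g "f 0"] by (simp add: g_def)
  have conj: "Z ** matrix_fun f M ** ctranspose Z = Z ** matrix_fun g M ** ctranspose Z + f 0 *\<^sub>R mat 1"
    if "psd_matrix M" "unitary_matrix Z" for M Z :: "complex ^ 'n ^ 'n"
    using that by (simp add: f unitary_matrix_def matrix_add_ldistrib matrix_mult_add_left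
        matrix_scalar_ac flip: scalar_matrix_assoc)
  let ?R = "U ** matrix_fun f A ** ctranspose U + V ** matrix_fun f B ** ctranspose V"
  \<comment> \<open>Unitary conjugation fixes multiples of the identity. The constant
    \<open>f 0\<close> enters \<open>?R\<close> twice and the subtracted term once, so one
    nonnegative copy is left over.\<close>
  have "?R - matrix_fun f (A + B) = (U ** matrix_fun g A ** ctranspose U
      + V ** matrix_fun g B ** ctranspose V - matrix_fun g (A + B)) + f 0 *\<^sub>R mat 1"
    unfolding conj[OF assms(4) U] conj[OF assms(5) V] f[OF AB] by simp
  moreover have "psd_matrix (f 0 *\<^sub>R mat 1 :: complex ^ 'n ^ 'n)"
    using assms(3) U by (simp add: psd_unitary_diag_iff flip: unitary_diag_const)
  ultimately have "psd_matrix (?R - matrix_fun f (A + B))"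
    using psd_matrix_add[OF psd] by metis
  moreover have "hermitian_matrix ?R" "hermitian_matrix (matrix_fun f (A + B))"
    using assms(4,5) AB
    by (simp_all add: hermitian_matrix_def ctranspose_add ctranspose_mult hermitian_matrix_fun matrix_mul_assoc)
  ultimately show ?thesis
    using U V unfolding loewner_le_def by blast
qed

end
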